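(* Let $M\in\mathbb{R}^{m\times n}$, let $0\le\epsilon<1$, let $\Omega\in\mathbb{R}^{d\times m}$ be an $\epsilon$-embedding of $\mathrm{range}(M)$, and put $M^{sk}=\Omega M$. Let $\Pi\in\mathbb{R}^{n\times n}$ be a permutation matrix and let $1\le k\le n$. Let $$M^{sk}\Pi=Q^{sk}R^{sk}=Q^{sk}\begin{pmatrix}R^{sk}_{11}&R^{sk}_{12}\\0&R^{sk}_{22}\end{pmatrix},\qquad M\Pi=QR=Q\begin{pmatrix}R_{11}&R_{12}\\0&R_{22}\end{pmatrix}$$ be $k$-partial QR factorizations, and assume that $\det(R_{11})\ne0$ and $\det(R_{11}^{sk})\neq0$. For $1\le i\le k$ and $1\le j\le n-k$, let $\bar R^{sk\,(i,j)}_{11}$ and $\bar R^{(i,j)}_{11}$ denote the leading $k\times k$ blocks of the $R$ factors of $k$-partial QR factorizations of $R^{sk}\Pi_{i,j+k}$ and $R\,\Pi_{i,j+k}$, respectively, where $\Pi_{i,j+k}$ is the permutation matrix interchanging columns $i$ and $j+k$. Then, for all $1\le i\le k$ and $1\le j\le n-k$, $$\sqrt{\frac{1-\epsilon}{1+\epsilon}}\left|\frac{\det(\bar R^{sk\,(i,j)}_{11})}{\det(R^{sk}_{11})}\right|\le\left|\frac{\det(\bar R^{(i,j)}_{11})}{\det(R_{11})}\right|\le\sqrt{\frac{1+\epsilon}{1-\epsilon}}\left|\frac{\det(\bar R^{sk\,(i,j)}_{11})}{\det(R^{sk}_{11})}\right|.$$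
   Context: All matrices are real. $\epsilon$-embedding: $\Omega\in\mathbb{R}^{d\times m}$ is an $\epsilon$-embedding of a subspace $V\subset\mathbb{R}^m$ if $|\langle\Omega x,\Omega y\rangle-\langle x,y\rangle|\le\epsilon\|x\|_2\|y\|_2$ for all $x,y\in V$. $k$-partial QR factorization: for $A\in\mathbb{R}^{p\times n}$ (with $k\le p$), a factorization $A=QR$ with $Q\in\mathbb{R}^{p\times p}$ orthogonal and $R=\begin{pmatrix}R_{11}&R_{12}\\0&R_{22}\end{pmatrix}$, where $R_{11}\in\mathbb{R}^{k\times k}$ is upper triangular, and $R_{12}\in\mathbb{R}^{k\times(n-k)}$, $R_{22}\in\mathbb{R}^{(p-k)\times(n-k)}$ are general. *)

theory Defs
  imports Complex_Main "Jordan_Normal_Form.Determinant"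
begin

definition mat_range :: "real mat \<Rightarrow> real vec set" where
  "mat_range A = (\<lambda>x. A *\<^sub>v x) ` carrier_vec (dim_col A)"

definition vec_norm2 :: "real vec \<Rightarrow> real" where
  "vec_norm2 x = sqrt (x \<bullet> x)"

text \<open>The inner products of images only make sense for vectors whose dimension is the number
  of columns of the matrix, hence the first conjunct.  The set \<open>V\<close> is meant to be a linear
  subspace; below it is always the range of a matrix.\<close>

definition eps_embedding :: "real \<Rightarrow> real mat \<Rightarrow> real vec set \<Rightarrow> bool" where
  "eps_embedding \<epsilon> \<Omega> V \<longleftrightarrow>
     V \<subseteq> carrier_vec (dim_col \<Omega>) \<and>
     (\<forall>x\<in>V. \<forall>y\<in>V.
        \<bar>(\<Omega> *\<^sub>v x) \<bullet> (\<Omega> *\<^sub>v y) - x \<bullet> y\<bar> \<le> \<epsilon> * vec_norm2 x * vec_norm2 y)"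

text \<open>Column \<open>j\<close> of \<open>perm_mat n \<pi>\<close> is the unit vector with index \<open>\<pi> j\<close>, so column \<open>j\<close> of
  \<open>A * perm_mat n \<pi>\<close> is column \<open>\<pi> j\<close> of \<open>A\<close>.\<close>

definition perm_mat :: "nat \<Rightarrow> (nat \<Rightarrow> nat) \<Rightarrow> real mat" where
  "perm_mat n \<pi> = mat n n (\<lambda>(i, j). if i = \<pi> j then 1 else 0)"

definition is_perm_mat :: "nat \<Rightarrow> real mat \<Rightarrow> bool" where
  "is_perm_mat n P \<longleftrightarrow> (\<exists>\<pi>. \<pi> permutes {..<n} \<and> P = perm_mat n \<pi>)"

definition col_swap_mat :: "nat \<Rightarrow> nat \<Rightarrow> nat \<Rightarrow> real mat" where
  "col_swap_mat n i j = perm_mat n (Transposition.transpose i j)"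

lemma mult_col_swap_mat:
  assumes "A \<in> carrier_mat r n" "i < n" "j < n"
  shows "A * col_swap_mat n i j = swapcols i j A"
proof -
  have "col_swap_mat n i j = swaprows_mat n i j"
    by (rule eq_matI)
      (auto simp: col_swap_mat_def perm_mat_def Transposition.transpose_def)
  with swapcols_mat[OF assms] show ?thesis by simp
qed

text \<open>Orthogonality here is \<open>Q\<^sup>T Q = Q Q\<^sup>T = I\<close>; the library predicate \<^const>\<open>orthogonal_mat\<close> only
  asks for nonzero, pairwise orthogonal columns.\<close>

definition is_orthogonal_mat :: "nat \<Rightarrow> real mat \<Rightarrow> bool" where
  "is_orthogonal_mat p Q \<longleftrightarrow>
     Q \<in> carrier_mat p p \<and> transpose_mat Q * Q = 1\<^sub>m p \<and> Q * transpose_mat Q = 1\<^sub>m p"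

definition partial_qr :: "nat \<Rightarrow> real mat \<Rightarrow> real mat \<Rightarrow> real mat \<Rightarrow> bool" where
  "partial_qr k A Q R \<longleftrightarrow>
     (let p = dim_row A; n = dim_col A in
        k \<le> p \<and> k \<le> n \<and> is_orthogonal_mat p Q \<and> A = Q * R \<and>
        (\<exists>R11 R12 R22.
           R11 \<in> carrier_mat k k \<and> upper_triangular R11 \<and>
           R12 \<in> carrier_mat k (n - k) \<and>
           R22 \<in> carrier_mat (p - k) (n - k) \<and>
           R = four_block_mat R11 R12 (0\<^sub>m (p - k) k) R22))"

definition leading_block :: "nat \<Rightarrow> real mat \<Rightarrow> real mat" where
  "leading_block k R = mat k k (\<lambda>(i, j). R $$ (i, j))"

lemma leading_block_four_block_mat:
  assumes "R11 \<in> carrier_mat k k" "R22 \<in> carrier_mat r s"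
  shows "leading_block k (four_block_mat R11 R12 R21 R22) = R11"
  using assms by (intro eq_matI) (auto simp: leading_block_def)

end

theory Submission
  imports Defs
begin

text \<open>
  Both determinant ratios are ratios of distances, and an \<open>\<epsilon>\<close>-embedding of the range distorts
  every such distance by a factor between \<open>sqrt (1 - \<epsilon>)\<close> and \<open>sqrt (1 + \<epsilon>)\<close>.

  Write \<open>A = M * P\<close> and let \<open>C\<close> consist of its first \<open>k\<close> columns.  Orthogonal factors leave
  inner products unchanged, so the squared determinant of the leading block is the Gram determinant
  of \<open>C\<close> (\<open>partial_qr_leading_block_det\<close>); since partial QR factorizations compose
  (\<open>partial_qr_update\<close>), the leading block after the interchange has as squared determinant the Gram
  determinant of \<open>C\<close> with column \<open>i\<close> replaced by column \<open>l = k + j\<close> of \<open>A\<close>.  A Gram determinant is a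
  squared volume, "base times height": with \<open>x\<close> in place of column \<open>i\<close>, the height is the distance of
  \<open>x\<close> from the span of the other \<open>k - 1\<close> columns, and the squared base is the cofactor at \<open>(i, i)\<close> of
  the Gram matrix of \<open>C\<close>, which does not depend on \<open>x\<close> (\<open>det_gram_replace_col\<close>).  In the quotient
  of the two determinants the base cancels, so the squared ratio is the quotient of the squared
  distances of columns \<open>l\<close> and \<open>i\<close> of \<open>A\<close> (\<open>partial_qr_swap_det_ratio\<close>).

  The same holds for the sketch, with \<open>\<Omega> * A\<close> in place of \<open>A\<close>.  The residuals whose lengths define
  the sketched distance are the images under \<open>\<Omega>\<close> of those that define the original one, and they
  lie in the range of \<open>M\<close>, where \<open>\<Omega>\<close> changes squared lengths by a factor between \<open>1 - \<epsilon>\<close> and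
  \<open>1 + \<epsilon>\<close>.  Infima inherit these bounds (\<open>col_dist2_sketch_bounds\<close>).  A quotient of two
  distances thus changes by at most \<open>sqrt ((1 + \<epsilon>) / (1 - \<epsilon>))\<close> either way.
\<close>

section \<open>Gram determinants and distances to the span of the other columns\<close>

definition gram_mat :: "real mat \<Rightarrow> real mat" where
  "gram_mat C = transpose_mat C * C"

text \<open>The condition \<open>z $ i = 0\<close> excludes column \<open>i\<close> while keeping its index: no column is deleted,
  so replacing column \<open>i\<close> does not require renumbering the others.\<close>

definition col_residuals :: "real mat \<Rightarrow> nat \<Rightarrow> real vec \<Rightarrow> real vec set" where
  "col_residuals C i x = (\<lambda>z. x - C *\<^sub>v z) ` {z \<in> carrier_vec (dim_col C). z $ i = 0}"

definition col_dist2 :: "real mat \<Rightarrow> nat \<Rightarrow> real vec \<Rightarrow> real" where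
  "col_dist2 C i x = (INF r\<in>col_residuals C i x. r \<bullet> r)"

lemma real_scalar_prod_self_nonneg: "0 \<le> (v :: real vec) \<bullet> v"
  by (auto simp: scalar_prod_def intro: sum_nonneg)

lemma real_scalar_prod_self_eq_0:
  assumes "(v :: real vec) \<bullet> v = 0"
  shows "v = 0\<^sub>v (dim_vec v)"
proof -
  have "(\<Sum>i\<in>{0..<dim_vec v}. v $ i * v $ i) = 0"
    using assms by (simp add: scalar_prod_def)
  then have "\<forall>i\<in>{0..<dim_vec v}. v $ i * v $ i = 0"
    by (subst (asm) sum_nonneg_eq_0_iff) auto
  then show ?thesis by (intro eq_vecI) auto
qed

lemma gram_mat_carrier: "C \<in> carrier_mat m k \<Longrightarrow> gram_mat C \<in> carrier_mat k k"
  by (auto simp: gram_mat_def)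

lemma gram_mat_index:
  assumes "C \<in> carrier_mat m k" "a < k" "b < k"
  shows "gram_mat C $$ (a, b) = col C a \<bullet> col C b"
  using assms by (auto simp: gram_mat_def)

lemma det_gram_mat_mult:
  assumes "C \<in> carrier_mat m k" "U \<in> carrier_mat k k"
  shows "det (gram_mat (C * U)) = (det U)\<^sup>2 * det (gram_mat C)"
proof -
  have G: "gram_mat C \<in> carrier_mat k k" using assms(1) by (rule gram_mat_carrier)
  have "gram_mat (C * U) = transpose_mat U * gram_mat C * U"
    unfolding gram_mat_def using assms
    by (simp add: transpose_mult[OF assms] assoc_mult_mat[of _ k k _ m _ k]
        assoc_mult_mat[of _ k m _ k _ k] assoc_mult_mat[of _ k k _ k _ k])
  also have "det \<dots> = (det U)\<^sup>2 * det (gram_mat C)"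
    using G assms(2) by (simp add: det_mult[of _ k] det_transpose[of _ k] power2_eq_square)
  finally show ?thesis .
qed

text \<open>The orthogonal projection of \<open>x\<close> onto the span of the columns other than \<open>i\<close>, obtained without
  passing to the smaller Gram matrix.  Projecting onto the span of all columns gives a residual
  orthogonal to each of them, but with a coefficient for column \<open>i\<close>.  That coefficient is removed by
  adding a multiple of \<open>C * h\<close>, where \<open>C\<^sup>T C h\<close> is the unit vector \<open>i\<close>: this vector is orthogonal
  to all columns except column \<open>i\<close>.\<close>

lemma obtain_residual_along_axis:
  assumes C: "C \<in> carrier_mat m k" and i: "i < k" and x: "x \<in> carrier_vec m"
    and nz: "det (gram_mat C) \<noteq> 0"
  obtains z t where "z \<in> carrier_vec k" "z $ i = 0"
    "transpose_mat C *\<^sub>v (x - C *\<^sub>v z) = t \<cdot>\<^sub>v unit_vec k i"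
proof -
  let ?G = "gram_mat C"
  have G: "?G \<in> carrier_mat k k" using C by (rule gram_mat_carrier)
  have CT: "transpose_mat C \<in> carrier_mat k m" using C by simp
  obtain H where H: "H \<in> carrier_mat k k" and GH: "?G * H = 1\<^sub>m k"
    using det_non_zero_imp_unit[OF G nz] by (auto simp: Units_def ring_mat_def)
  have solve: "?G *\<^sub>v (H *\<^sub>v b) = b" if "b \<in> carrier_vec k" for b
    using assoc_mult_mat_vec[OF G H that] GH that by simp
  define h where "h = H *\<^sub>v unit_vec k i"
  define y where "y = H *\<^sub>v (transpose_mat C *\<^sub>v x)"
  have h: "h \<in> carrier_vec k" and y: "y \<in> carrier_vec k"
    using H CT x by (auto simp: h_def y_def intro!: mult_mat_vec_carrier)
  have Gh: "?G *\<^sub>v h = unit_vec k i" unfolding h_def by (rule solve) simp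
  have Gy: "?G *\<^sub>v y = transpose_mat C *\<^sub>v x"
    unfolding y_def using CT x by (intro solve) auto
  have Gv: "?G *\<^sub>v v = transpose_mat C *\<^sub>v (C *\<^sub>v v)" if "v \<in> carrier_vec k" for v
    unfolding gram_mat_def using assoc_mult_mat_vec[OF CT C that] .
  have Ch: "C *\<^sub>v h \<in> carrier_vec m" using C h by simp
  \<comment> \<open>The multiple exists because the diagonal entry \<open>h $ i\<close> of the inverse Gram matrix is a squared
    length.\<close>
  have "h $ i = unit_vec k i \<bullet> h" using i h by simp
  also have "\<dots> = (C *\<^sub>v h) \<bullet> (C *\<^sub>v h)"
    unfolding Gh[symmetric] Gv[OF h] by (rule transpose_vec_mult_scalar[OF C h Ch])
  finally have hi: "h $ i = (C *\<^sub>v h) \<bullet> (C *\<^sub>v h)" .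
  have hi0: "h $ i \<noteq> 0"
  proof
    assume "h $ i = 0"
    with hi have "C *\<^sub>v h = 0\<^sub>v m"
      using real_scalar_prod_self_eq_0[of "C *\<^sub>v h"] C by simp
    with Gv[OF h] Gh have "unit_vec k i = transpose_mat C *\<^sub>v (0\<^sub>v m :: real vec)" by simp
    also have "\<dots> = 0\<^sub>v k" using CT by (intro eq_vecI) auto
    finally have "unit_vec k i $ i = (0\<^sub>v k :: real vec) $ i" by simp
    then show False using i by simp
  qed
  define t where "t = y $ i / h $ i"
  define z where "z = y - t \<cdot>\<^sub>v h"
  have z: "z \<in> carrier_vec k" using h y by (simp add: z_def)
  have zi: "z $ i = 0" using h y i hi0 by (simp add: z_def t_def)
  have Cz: "C *\<^sub>v z \<in> carrier_vec m" using C z by simp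
  have th: "t \<cdot>\<^sub>v h \<in> carrier_vec k" using h by simp
  have "transpose_mat C *\<^sub>v (x - C *\<^sub>v z) = transpose_mat C *\<^sub>v x - ?G *\<^sub>v z"
    by (simp add: mult_minus_distrib_mat_vec[OF CT x Cz] Gv[OF z])
  also have "?G *\<^sub>v z = transpose_mat C *\<^sub>v x - t \<cdot>\<^sub>v unit_vec k i"
    unfolding z_def using mult_minus_distrib_mat_vec[OF G y th]
      mult_mat_vec[OF G h, of t] Gy Gh by simp
  also have "transpose_mat C *\<^sub>v x - (transpose_mat C *\<^sub>v x - t \<cdot>\<^sub>v unit_vec k i)
      = t \<cdot>\<^sub>v unit_vec k i"
    using CT x by (intro eq_vecI) auto
  finally show ?thesis using that z zi by blast
qed

lemma replace_col_carrier: "C \<in> carrier_mat m k \<Longrightarrow> replace_col C x i \<in> carrier_mat m k"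
  by (auto simp: replace_col_def)

lemma col_replace_col:
  assumes "C \<in> carrier_mat m k" "x \<in> carrier_vec m" "a < k"
  shows "col (replace_col C x i) a = (if a = i then x else col C a)"
  using assms by (intro eq_vecI) (auto simp: replace_col_def)

text \<open>If \<open>r\<close> is orthogonal to the other columns, then row \<open>i\<close> of the new Gram matrix vanishes off the
  diagonal, and expansion along it leaves one cofactor.  That cofactor ignores row and column \<open>i\<close>,
  hence does not change when column \<open>i\<close> of \<open>C\<close> does.\<close>

lemma det_gram_orthogonal_col:
  assumes C: "C \<in> carrier_mat m k" and i: "i < k" and r: "r \<in> carrier_vec m"
    and orth: "transpose_mat C *\<^sub>v r = t \<cdot>\<^sub>v unit_vec k i"
  shows "det (gram_mat (replace_col C r i)) = (r \<bullet> r) * cofactor (gram_mat C) i i"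
proof -
  let ?D = "replace_col C r i"
  let ?G = "gram_mat ?D"
  have D: "?D \<in> carrier_mat m k" using C by (rule replace_col_carrier)
  have G: "?G \<in> carrier_mat k k" using D by (rule gram_mat_carrier)
  have G0: "gram_mat C \<in> carrier_mat k k" using C by (rule gram_mat_carrier)
  have "r \<bullet> col C b = 0" if "b < k" "b \<noteq> i" for b
  proof -
    have "col C b \<bullet> r = (transpose_mat C *\<^sub>v r) $ b" using C that by simp
    also have "\<dots> = 0" unfolding orth using that i by simp
    finally show ?thesis using comm_scalar_prod[OF r, of "col C b"] C that by simp
  qed
  then have row_i: "?G $$ (i, b) = (if b = i then r \<bullet> r else 0)" if "b < k" for b
    using that i by (simp add: gram_mat_index[OF D] col_replace_col[OF C r])
  have "det ?G = (\<Sum>b<k. ?G $$ (i, b) * cofactor ?G i b)"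
    by (rule laplace_expansion_row[OF G i])
  also have "\<dots> = (\<Sum>b<k. if b = i then (r \<bullet> r) * cofactor ?G i i else 0)"
    by (intro sum.cong refl) (simp add: row_i)
  also have "\<dots> = (r \<bullet> r) * cofactor ?G i i" using i by simp
  also have "mat_delete ?G i i = mat_delete (gram_mat C) i i"
    using G G0
    by (intro eq_matI)
      (auto simp: mat_delete_def gram_mat_index[OF D] gram_mat_index[OF C] col_replace_col[OF C r])
  then have "cofactor ?G i i = cofactor (gram_mat C) i i" by (simp add: cofactor_def)
  finally show ?thesis .
qed

text \<open>Subtracting multiples of the other columns from column \<open>i\<close> is right multiplication by the
  identity with column \<open>i\<close> replaced by \<open>unit_vec k i - z\<close>.  By Cramer's rule, the determinant of
  this matrix is its entry at \<open>(i, i)\<close>, which is 1.\<close>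

lemma det_gram_column_operation:
  assumes C: "C \<in> carrier_mat m k" and i: "i < k" and x: "x \<in> carrier_vec m"
    and z: "z \<in> carrier_vec k" and zi: "z $ i = 0"
  shows "det (gram_mat (replace_col C (x - C *\<^sub>v z) i)) = det (gram_mat (replace_col C x i))"
proof -
  define u where "u = unit_vec k i - z"
  define U where "U = replace_col (1\<^sub>m k) u i"
  have u: "u \<in> carrier_vec k" using z by (simp add: u_def)
  have U: "U \<in> carrier_mat k k" unfolding U_def by (rule replace_col_carrier) simp
  have D: "replace_col C x i \<in> carrier_mat m k" using C by (rule replace_col_carrier)
  have "det U = u $ i"
    using cramer_lemma_mat[of "1\<^sub>m k" k u i] u i by (simp add: U_def)
  then have detU: "det U = 1" using i z zi by (simp add: u_def)
  have Cz: "C *\<^sub>v z \<in> carrier_vec m" using C z by simp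
  have "replace_col C (x - C *\<^sub>v z) i = replace_col C x i * U"
  proof (rule eq_matI)
    fix a b assume "a < dim_row (replace_col C x i * U)" "b < dim_col (replace_col C x i * U)"
    then have a: "a < m" and b: "b < k" using D U by auto
    have entry: "(replace_col C x i * U) $$ (a, b)
        = (\<Sum>c\<in>{0..<k}. replace_col C x i $$ (a, c) * U $$ (c, b))"
      using a b D U by (simp add: scalar_prod_def)
    show "replace_col C (x - C *\<^sub>v z) i $$ (a, b) = (replace_col C x i * U) $$ (a, b)"
    proof (cases "b = i")
      case False
      have "(\<Sum>c\<in>{0..<k}. replace_col C x i $$ (a, c) * U $$ (c, b))
          = (\<Sum>c\<in>{0..<k}. if c = b then C $$ (a, b) else 0)"
        using a b C False by (intro sum.cong refl) (auto simp: U_def replace_col_def)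
      with entry a b C False show ?thesis by (simp add: replace_col_def)
    next
      case True
      have "(\<Sum>c\<in>{0..<k}. replace_col C x i $$ (a, c) * U $$ (c, b))
          = (\<Sum>c\<in>{0..<k}. (if c = i then x $ a else 0) - C $$ (a, c) * z $ c)"
        using a i C z zi True
        by (intro sum.cong refl) (auto simp: U_def u_def replace_col_def)
      also have "\<dots> = x $ a - (\<Sum>c\<in>{0..<k}. C $$ (a, c) * z $ c)"
        using i by (simp add: sum_subtractf)
      also have "(\<Sum>c\<in>{0..<k}. C $$ (a, c) * z $ c) = (C *\<^sub>v z) $ a"
        using a C z by (simp add: scalar_prod_def)
      finally show ?thesis using entry a i C Cz True by (simp add: replace_col_def)
    qed
  qed (use C U in \<open>auto simp: replace_col_def\<close>)
  then show ?thesis using det_gram_mat_mult[OF D U] detU by simp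
qed

text \<open>Pythagoras: any other residual differs from the orthogonal one by a combination of the columns
  other than \<open>i\<close>, and these are orthogonal to it.  In particular the infimum is attained.\<close>

lemma col_dist2_eq_orthogonal_residual:
  assumes C: "C \<in> carrier_mat m k" and i: "i < k" and x: "x \<in> carrier_vec m"
    and z: "z \<in> carrier_vec k" and zi: "z $ i = 0"
    and orth: "transpose_mat C *\<^sub>v (x - C *\<^sub>v z) = t \<cdot>\<^sub>v unit_vec k i"
  shows "col_dist2 C i x = (x - C *\<^sub>v z) \<bullet> (x - C *\<^sub>v z)"
  unfolding col_dist2_def
proof (rule cInf_eq_minimum)
  let ?r = "x - C *\<^sub>v z"
  show "?r \<bullet> ?r \<in> (\<lambda>r. r \<bullet> r) ` col_residuals C i x"
    using C z zi by (auto simp: col_residuals_def)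
  fix s assume "s \<in> (\<lambda>r. r \<bullet> r) ` col_residuals C i x"
  then obtain w where w: "w \<in> carrier_vec k" "w $ i = 0"
    and s: "s = (x - C *\<^sub>v w) \<bullet> (x - C *\<^sub>v w)"
    using C by (auto simp: col_residuals_def)
  define v where "v = z - w"
  have v: "v \<in> carrier_vec k" "v $ i = 0" using z w zi i by (auto simp: v_def)
  have r: "?r \<in> carrier_vec m" using C x z by auto
  have Cv: "C *\<^sub>v v \<in> carrier_vec m" using C v by simp
  have "x - C *\<^sub>v w = ?r + C *\<^sub>v v"
    unfolding v_def mult_minus_distrib_mat_vec[OF C z w(1)]
    using C x z w by (intro eq_vecI) auto
  then have "s = ?r \<bullet> ?r + 2 * (?r \<bullet> (C *\<^sub>v v)) + (C *\<^sub>v v) \<bullet> (C *\<^sub>v v)"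
    using r Cv by (simp add: s add_scalar_prod_distrib[of _ m] scalar_prod_add_distrib[of _ m]
        comm_scalar_prod[of "C *\<^sub>v v" m ?r])
  also have "?r \<bullet> (C *\<^sub>v v) = (transpose_mat C *\<^sub>v ?r) \<bullet> v"
    by (rule transpose_vec_mult_scalar[OF C v(1) r, symmetric])
  also have "\<dots> = 0" unfolding orth using v i by simp
  finally show "?r \<bullet> ?r \<le> s"
    using real_scalar_prod_self_nonneg[of "C *\<^sub>v v"] by simp
qed

lemma det_gram_replace_col:
  assumes C: "C \<in> carrier_mat m k" and i: "i < k" and x: "x \<in> carrier_vec m"
    and nz: "det (gram_mat C) \<noteq> 0"
  shows "det (gram_mat (replace_col C x i)) = col_dist2 C i x * cofactor (gram_mat C) i i"
proof -
  obtain z t where z: "z \<in> carrier_vec k" "z $ i = 0"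
    and orth: "transpose_mat C *\<^sub>v (x - C *\<^sub>v z) = t \<cdot>\<^sub>v unit_vec k i"
    using obtain_residual_along_axis[OF C i x nz] .
  have r: "x - C *\<^sub>v z \<in> carrier_vec m" using C x z by auto
  show ?thesis
    using det_gram_column_operation[OF C i x z] det_gram_orthogonal_col[OF C i r orth]
      col_dist2_eq_orthogonal_residual[OF C i x z orth] by simp
qed

text \<open>Replacing column \<open>i\<close> by itself shows that the Gram determinant of \<open>C\<close> has the same cofactor
  as a factor; so the cofactor is nonzero and cancels, and the denominator is nonzero.\<close>

lemma det_gram_replace_col_ratio:
  assumes C: "C \<in> carrier_mat m k" and i: "i < k" and x: "x \<in> carrier_vec m"
    and nz: "det (gram_mat C) \<noteq> 0"
  shows "det (gram_mat (replace_col C x i)) / det (gram_mat C)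
      = col_dist2 C i x / col_dist2 C i (col C i)"
    and "col_dist2 C i (col C i) \<noteq> 0"
proof -
  have "replace_col C (col C i) i = C"
    using C i by (intro eq_matI) (auto simp: replace_col_def)
  moreover have "col C i \<in> carrier_vec m" using C by auto
  ultimately have self: "det (gram_mat C) = col_dist2 C i (col C i) * cofactor (gram_mat C) i i"
    using det_gram_replace_col[OF C i _ nz, of "col C i"] by metis
  with nz show "col_dist2 C i (col C i) \<noteq> 0" by auto
  show "det (gram_mat (replace_col C x i)) / det (gram_mat C)
      = col_dist2 C i x / col_dist2 C i (col C i)"
    using nz unfolding det_gram_replace_col[OF C i x nz] self by simp
qed

section \<open>Distances under an embedding\<close>

lemma col_residuals_nonempty:
  assumes "i < dim_col C"
  shows "col_residuals C i x \<noteq> {}"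
proof -
  have "0\<^sub>v (dim_col C) \<in> {z \<in> carrier_vec (dim_col C). z $ i = 0}" using assms by simp
  then show ?thesis unfolding col_residuals_def by blast
qed

lemma col_dist2_le: "r \<in> col_residuals C i x \<Longrightarrow> col_dist2 C i x \<le> r \<bullet> r"
  unfolding col_dist2_def
  by (rule cINF_lower) (auto intro!: bdd_belowI2[of _ 0] real_scalar_prod_self_nonneg)

lemma le_col_dist2:
  assumes "i < dim_col C" "\<And>r. r \<in> col_residuals C i x \<Longrightarrow> c \<le> r \<bullet> r"
  shows "c \<le> col_dist2 C i x"
  unfolding col_dist2_def using assms by (intro cINF_greatest col_residuals_nonempty) auto

lemma col_dist2_nonneg: "i < dim_col C \<Longrightarrow> 0 \<le> col_dist2 C i x"
  by (rule le_col_dist2[OF _ real_scalar_prod_self_nonneg])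

lemma col_residuals_image:
  assumes C: "C \<in> carrier_mat m k" and W: "\<Omega> \<in> carrier_mat d m" and x: "x \<in> carrier_vec m"
  shows "col_residuals (\<Omega> * C) i (\<Omega> *\<^sub>v x) = (\<lambda>r. \<Omega> *\<^sub>v r) ` col_residuals C i x"
proof -
  have "\<Omega> *\<^sub>v x - (\<Omega> * C) *\<^sub>v z = \<Omega> *\<^sub>v (x - C *\<^sub>v z)" if "z \<in> carrier_vec k" for z
  proof -
    have Cz: "C *\<^sub>v z \<in> carrier_vec m" using C that by simp
    show ?thesis
      using assoc_mult_mat_vec[OF W C that] mult_minus_distrib_mat_vec[OF W x Cz] by simp
  qed
  then show ?thesis
    using C W unfolding col_residuals_def image_image by (intro image_cong) auto
qed

text \<open>Since the residuals of the sketch are the sketched residuals, a bound on the distortion of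
  each of them carries over to the infimum of their squared lengths.\<close>

lemma col_dist2_sketch_bounds:
  assumes C: "C \<in> carrier_mat m k" and W: "\<Omega> \<in> carrier_mat d m" and x: "x \<in> carrier_vec m"
    and i: "i < k" and "0 \<le> \<epsilon>" "\<epsilon> < 1"
    and dist: "\<And>r. r \<in> col_residuals C i x \<Longrightarrow> \<bar>(\<Omega> *\<^sub>v r) \<bullet> (\<Omega> *\<^sub>v r) - r \<bullet> r\<bar> \<le> \<epsilon> * (r \<bullet> r)"
  shows "(1 - \<epsilon>) * col_dist2 C i x \<le> col_dist2 (\<Omega> * C) i (\<Omega> *\<^sub>v x)"
    and "col_dist2 (\<Omega> * C) i (\<Omega> *\<^sub>v x) \<le> (1 + \<epsilon>) * col_dist2 C i x"
proof -
  have dims: "i < dim_col C" "i < dim_col (\<Omega> * C)" using C i by auto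
  note image = col_residuals_image[OF C W x, of i]
  show "(1 - \<epsilon>) * col_dist2 C i x \<le> col_dist2 (\<Omega> * C) i (\<Omega> *\<^sub>v x)"
  proof (rule le_col_dist2[OF dims(2)])
    fix s assume "s \<in> col_residuals (\<Omega> * C) i (\<Omega> *\<^sub>v x)"
    then obtain r where r: "r \<in> col_residuals C i x" and s: "s = \<Omega> *\<^sub>v r"
      unfolding image by auto
    have "(1 - \<epsilon>) * col_dist2 C i x \<le> (1 - \<epsilon>) * (r \<bullet> r)"
      using col_dist2_le[OF r] \<open>\<epsilon> < 1\<close> by (intro mult_left_mono) auto
    also have "\<dots> \<le> s \<bullet> s" using dist[OF r] unfolding s left_diff_distrib by linarith
    finally show "(1 - \<epsilon>) * col_dist2 C i x \<le> s \<bullet> s" .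
  qed
  have "col_dist2 (\<Omega> * C) i (\<Omega> *\<^sub>v x) / (1 + \<epsilon>) \<le> col_dist2 C i x"
  proof (rule le_col_dist2[OF dims(1)])
    fix r assume r: "r \<in> col_residuals C i x"
    then have "col_dist2 (\<Omega> * C) i (\<Omega> *\<^sub>v x) \<le> (\<Omega> *\<^sub>v r) \<bullet> (\<Omega> *\<^sub>v r)"
      by (intro col_dist2_le) (auto simp: image)
    also have "\<dots> \<le> (1 + \<epsilon>) * (r \<bullet> r)" using dist[OF r] unfolding distrib_right by linarith
    finally show "col_dist2 (\<Omega> * C) i (\<Omega> *\<^sub>v x) / (1 + \<epsilon>) \<le> r \<bullet> r"
      using \<open>0 \<le> \<epsilon>\<close> by (simp add: field_simps)
  qed
  then show "col_dist2 (\<Omega> * C) i (\<Omega> *\<^sub>v x) \<le> (1 + \<epsilon>) * col_dist2 C i x"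
    using \<open>0 \<le> \<epsilon>\<close> by (simp add: field_simps)
qed

section \<open>Leading columns\<close>

definition first_cols :: "nat \<Rightarrow> real mat \<Rightarrow> real mat" where
  "first_cols k A = mat (dim_row A) k (\<lambda>(i, j). A $$ (i, j))"

lemma first_cols_carrier: "A \<in> carrier_mat m n \<Longrightarrow> first_cols k A \<in> carrier_mat m k"
  by (auto simp: first_cols_def)

lemma col_first_cols:
  assumes "A \<in> carrier_mat m n" "k \<le> n" "j < k"
  shows "col (first_cols k A) j = col A j"
  using assms by (intro eq_vecI) (auto simp: first_cols_def)

lemma first_cols_mult:
  assumes "B \<in> carrier_mat d m" "A \<in> carrier_mat m n" "k \<le> n"
  shows "first_cols k (B * A) = B * first_cols k A"
proof (rule eq_matI)
  fix i j assume "i < dim_row (B * first_cols k A)" "j < dim_col (B * first_cols k A)"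
  then have "i < d" "j < k" using assms by (auto simp: first_cols_def)
  then show "first_cols k (B * A) $$ (i, j) = (B * first_cols k A) $$ (i, j)"
    using assms col_first_cols[OF assms(2,3)] first_cols_carrier[OF assms(2), of k]
    by (simp add: first_cols_def)
qed (use assms in \<open>auto simp: first_cols_def\<close>)

lemma first_cols_residual_in_range:
  assumes A: "A \<in> carrier_mat m n" and kn: "k \<le> n" and l: "l < n"
    and r: "r \<in> col_residuals (first_cols k A) i (col A l)"
  shows "r \<in> mat_range A"
proof -
  obtain z where z: "z \<in> carrier_vec k" and rz: "r = col A l - first_cols k A *\<^sub>v z"
    using r by (auto simp: col_residuals_def first_cols_def)
  define E where "E = first_cols k (1\<^sub>m n)"
  have E: "E \<in> carrier_mat n k" unfolding E_def by (rule first_cols_carrier[of _ n n]) simp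
  have C: "first_cols k A = A * E"
    using first_cols_mult[OF A _ kn, of "1\<^sub>m n"] A by (simp add: E_def)
  have Ez: "E *\<^sub>v z \<in> carrier_vec n" using E z by simp
  have "col A l = A *\<^sub>v unit_vec n l"
    using A l by (intro eq_vecI) auto
  then have "r = A *\<^sub>v (unit_vec n l - E *\<^sub>v z)"
    unfolding rz C using assoc_mult_mat_vec[OF A E z]
      mult_minus_distrib_mat_vec[OF A _ Ez, of "unit_vec n l"] by simp
  then show ?thesis using A Ez by (auto simp: mat_range_def)
qed

lemma mat_range_mult_subset:
  assumes "A \<in> carrier_mat m n" "B \<in> carrier_mat n l"
  shows "mat_range (A * B) \<subseteq> mat_range A"
  using assms assoc_mult_mat_vec[OF assms] by (auto simp: mat_range_def)

lemma eps_embedding_norm: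
  assumes "eps_embedding \<epsilon> \<Omega> V" "v \<in> V"
  shows "\<bar>(\<Omega> *\<^sub>v v) \<bullet> (\<Omega> *\<^sub>v v) - v \<bullet> v\<bar> \<le> \<epsilon> * (v \<bullet> v)"
proof -
  have "vec_norm2 v * vec_norm2 v = v \<bullet> v"
    using real_scalar_prod_self_nonneg[of v] by (simp add: vec_norm2_def)
  with assms show ?thesis unfolding eps_embedding_def by (metis mult.assoc)
qed

lemma first_cols_swapcols:
  assumes "A \<in> carrier_mat m n" "k \<le> n" "i < k" "k \<le> l" "l < n"
  shows "first_cols k (swapcols i l A) = replace_col (first_cols k A) (col A l) i"
  using assms by (intro eq_matI) (auto simp: first_cols_def replace_col_def)

section \<open>Partial QR factorizations\<close>

lemma partial_qr_carriers:
  assumes "partial_qr k A Q R" "A \<in> carrier_mat p n"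
  shows "k \<le> p" "k \<le> n" "Q \<in> carrier_mat p p" "R \<in> carrier_mat p n"
proof -
  have dims: "dim_row A = p" "dim_col A = n" using assms(2) by auto
  from assms(1) have kp: "k \<le> p" and kn: "k \<le> n" and Q: "Q \<in> carrier_mat p p"
    unfolding partial_qr_def is_orthogonal_mat_def Let_def dims by blast+
  from assms(1) obtain R11 R12 R22 where "R11 \<in> carrier_mat k k" "R22 \<in> carrier_mat (p - k) (n - k)"
    and R: "R = four_block_mat R11 R12 (0\<^sub>m (p - k) k) R22"
    unfolding partial_qr_def Let_def dims by blast
  then have "R \<in> carrier_mat (k + (p - k)) (k + (n - k))"
    unfolding R by (intro four_block_carrier_mat)
  with kp kn Q show "k \<le> p" "k \<le> n" "Q \<in> carrier_mat p p" "R \<in> carrier_mat p n"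
    by simp_all
qed

text \<open>The first \<open>k\<close> columns of \<open>A\<close> are \<open>Q\<close> times the leading block stacked on a zero block.  Neither
  \<open>Q\<close> nor the zero block contributes to the Gram matrix.\<close>

lemma partial_qr_leading_block_det:
  assumes qr: "partial_qr k A Q R" and A: "A \<in> carrier_mat p n"
  shows "(det (leading_block k R))\<^sup>2 = det (gram_mat (first_cols k A))"
proof -
  note car = partial_qr_carriers[OF qr A]
  from qr A obtain R11 R12 R22 where R11: "R11 \<in> carrier_mat k k"
    and "R12 \<in> carrier_mat k (n - k)" and R22: "R22 \<in> carrier_mat (p - k) (n - k)"
    and R: "R = four_block_mat R11 R12 (0\<^sub>m (p - k) k) R22"
    and QQ: "transpose_mat Q * Q = 1\<^sub>m p" and AQR: "A = Q * R"
    unfolding partial_qr_def is_orthogonal_mat_def Let_def by (metis carrier_matD)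
  let ?F = "first_cols k R"
  have lead: "leading_block k R = R11"
    unfolding R by (rule leading_block_four_block_mat[OF R11 R22])
  have F: "?F \<in> carrier_mat p k" using car(4) by (rule first_cols_carrier)
  have QT: "transpose_mat Q \<in> carrier_mat p p" using car(3) by simp
  have FT: "transpose_mat ?F \<in> carrier_mat k p" using F by simp
  have QF: "Q * ?F \<in> carrier_mat p k" using car(3) F by simp
  have "gram_mat (first_cols k A) = transpose_mat (Q * ?F) * (Q * ?F)"
    unfolding AQR first_cols_mult[OF car(3,4,2)] by (simp add: gram_mat_def)
  also have "\<dots> = transpose_mat ?F * (transpose_mat Q * (Q * ?F))"
    unfolding transpose_mult[OF car(3) F] by (rule assoc_mult_mat[OF FT QT QF])
  also have "transpose_mat Q * (Q * ?F) = ?F"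
    using assoc_mult_mat[OF QT car(3) F] QQ F by simp
  also have "transpose_mat ?F * ?F = transpose_mat R11 * R11"
  proof (rule eq_matI)
    fix a b assume "a < dim_row (transpose_mat R11 * R11)" "b < dim_col (transpose_mat R11 * R11)"
    then have ab: "a < k" "b < k" using R11 by auto
    have entry: "?F $$ (c, j) = (if c < k then R11 $$ (c, j) else 0)" if "c < p" "j < k" for c j
      using that R11 R22 car by (auto simp: first_cols_def R)
    have "(transpose_mat ?F * ?F) $$ (a, b) = (\<Sum>c\<in>{0..<p}. ?F $$ (c, a) * ?F $$ (c, b))"
      using ab F by (simp add: scalar_prod_def)
    also have "\<dots> = (\<Sum>c\<in>{0..<k}. R11 $$ (c, a) * R11 $$ (c, b))"
      using ab car(1) by (intro sum.mono_neutral_cong_right) (auto simp: entry)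
    also have "\<dots> = (transpose_mat R11 * R11) $$ (a, b)"
      using ab R11 by (simp add: scalar_prod_def)
    finally show "(transpose_mat ?F * ?F) $$ (a, b) = (transpose_mat R11 * R11) $$ (a, b)" .
  qed (use F R11 in auto)
  also have "det \<dots> = (det R11)\<^sup>2"
    using R11 by (simp add: det_mult[of _ k] det_transpose[of _ k] power2_eq_square)
  finally show ?thesis unfolding lead by simp
qed

lemma is_orthogonal_mat_mult:
  assumes "is_orthogonal_mat p Q" "is_orthogonal_mat p S"
  shows "is_orthogonal_mat p (Q * S)"
proof -
  have c: "Q \<in> carrier_mat p p" "S \<in> carrier_mat p p"
      "transpose_mat Q \<in> carrier_mat p p" "transpose_mat S \<in> carrier_mat p p"
    using assms by (auto simp: is_orthogonal_mat_def)
  have QS: "Q * S \<in> carrier_mat p p" "transpose_mat S * transpose_mat Q \<in> carrier_mat p p"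
    using mult_carrier_mat[OF c(1,2)] mult_carrier_mat[OF c(4,3)] by blast+
  have "transpose_mat S * transpose_mat Q * (Q * S) = transpose_mat S * (transpose_mat Q * (Q * S))"
    by (rule assoc_mult_mat[OF c(4) c(3) QS(1)])
  also have "transpose_mat Q * (Q * S) = S"
    using assoc_mult_mat[OF c(3) c(1) c(2)] assms(1) c(2) by (simp add: is_orthogonal_mat_def)
  finally have left: "transpose_mat S * transpose_mat Q * (Q * S) = 1\<^sub>m p"
    using assms(2) by (simp add: is_orthogonal_mat_def)
  have "Q * S * (transpose_mat S * transpose_mat Q) = Q * (S * (transpose_mat S * transpose_mat Q))"
    by (rule assoc_mult_mat[OF c(1) c(2) QS(2)])
  also have "S * (transpose_mat S * transpose_mat Q) = transpose_mat Q"
    using assoc_mult_mat[OF c(2) c(4) c(3)] assms(2) c(3) by (simp add: is_orthogonal_mat_def)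
  finally have right: "Q * S * (transpose_mat S * transpose_mat Q) = 1\<^sub>m p"
    using assms(1) by (simp add: is_orthogonal_mat_def)
  show ?thesis
    unfolding is_orthogonal_mat_def transpose_mult[OF c(1) c(2)] using QS left right by blast
qed

text \<open>This turns the factorizations of the column-interchanged \<open>R\<close> factors into factorizations of the
  column-interchanged matrices themselves, so that only Gram matrices of the latter matter.\<close>

lemma partial_qr_update:
  assumes qr: "partial_qr k A Q R" and A: "A \<in> carrier_mat p n" and T: "T \<in> carrier_mat n n"
    and qrb: "partial_qr k (R * T) Qb Rb"
  shows "partial_qr k (A * T) (Q * Qb) Rb"
proof -
  note car = partial_qr_carriers[OF qr A]
  have RT: "R * T \<in> carrier_mat p n" using car T by simp
  note carb = partial_qr_carriers[OF qrb RT]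
  have "A * T = Q * (R * T)"
    using qr assoc_mult_mat[OF car(3,4) T] by (simp add: partial_qr_def Let_def)
  also have "R * T = Qb * Rb" using qrb by (simp add: partial_qr_def Let_def)
  also have "Q * (Qb * Rb) = Q * Qb * Rb"
    by (rule assoc_mult_mat[OF car(3) carb(3,4), symmetric])
  finally have "A * T = Q * Qb * Rb" .
  moreover have "is_orthogonal_mat p (Q * Qb)"
    using qr qrb A RT car T by (intro is_orthogonal_mat_mult) (auto simp: partial_qr_def Let_def)
  moreover have dims: "dim_row (R * T) = p" "dim_col (R * T) = n"
      "dim_row (A * T) = p" "dim_col (A * T) = n"
    using A T car by auto
  ultimately show ?thesis using qrb unfolding partial_qr_def Let_def dims by blast
qed

lemma partial_qr_swap_det_ratio:
  assumes qr: "partial_qr k A Q R" and A: "A \<in> carrier_mat p n"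
    and i: "i < k" and l: "k \<le> l" "l < n"
    and qrb: "partial_qr k (R * col_swap_mat n i l) Qb Rb"
    and nz: "det (leading_block k R) \<noteq> 0"
  defines "C \<equiv> first_cols k A"
  shows "(det (leading_block k Rb) / det (leading_block k R))\<^sup>2
      = col_dist2 C i (col A l) / col_dist2 C i (col A i)"
    and "col_dist2 C i (col A i) > 0"
proof -
  note car = partial_qr_carriers[OF qr A]
  have T: "col_swap_mat n i l \<in> carrier_mat n n" by (simp add: col_swap_mat_def perm_mat_def)
  have C: "C \<in> carrier_mat p k" unfolding C_def using A by (rule first_cols_carrier)
  have detR: "(det (leading_block k R))\<^sup>2 = det (gram_mat C)"
    unfolding C_def by (rule partial_qr_leading_block_det[OF qr A])
  have "A * col_swap_mat n i l = swapcols i l A"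
    using mult_col_swap_mat[OF A, of i l] i l by simp
  then have "first_cols k (A * col_swap_mat n i l) = replace_col C (col A l) i"
    unfolding C_def using first_cols_swapcols[OF A car(2) i l] by simp
  then have detRb: "(det (leading_block k Rb))\<^sup>2 = det (gram_mat (replace_col C (col A l) i))"
    using partial_qr_leading_block_det[OF partial_qr_update[OF qr A T qrb], of p n] A T by simp
  have nzC: "det (gram_mat C) \<noteq> 0" using nz by (simp flip: detR)
  have ci: "col C i = col A i" unfolding C_def by (rule col_first_cols[OF A car(2) i])
  have x: "col A l \<in> carrier_vec p" using A by auto
  show "(det (leading_block k Rb) / det (leading_block k R))\<^sup>2
      = col_dist2 C i (col A l) / col_dist2 C i (col A i)"
    using det_gram_replace_col_ratio(1)[OF C i x nzC] by (simp add: power_divide detR detRb ci)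
  show "col_dist2 C i (col A i) > 0"
    using det_gram_replace_col_ratio(2)[OF C i x nzC] col_dist2_nonneg[of i C "col A i"] C i
    by (simp add: ci)
qed

section \<open>Sketched and original determinant ratios\<close>

lemma sqrt_quotient_bounds:
  fixes a b c d q s \<epsilon> :: real
  assumes e: "0 \<le> \<epsilon>" "\<epsilon> < 1"
    and q: "q\<^sup>2 = a / b" "b > 0" and s: "s\<^sup>2 = c / d" "d > 0" and "a \<ge> 0" "c \<ge> 0"
    and ac: "(1 - \<epsilon>) * a \<le> c" "c \<le> (1 + \<epsilon>) * a"
    and bd: "(1 - \<epsilon>) * b \<le> d" "d \<le> (1 + \<epsilon>) * b"
  shows "sqrt ((1 - \<epsilon>) / (1 + \<epsilon>)) * \<bar>s\<bar> \<le> \<bar>q\<bar>"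
    and "\<bar>q\<bar> \<le> sqrt ((1 + \<epsilon>) / (1 - \<epsilon>)) * \<bar>s\<bar>"
proof -
  have cross: "u / v \<le> w / y" if "v > 0" "y > 0" "u * y \<le> w * v" for u v w y :: real
    using that by (simp add: field_simps)
  have "((1 - \<epsilon>) * b) * c \<le> d * ((1 + \<epsilon>) * a)"
    using ac bd e q s assms by (intro mult_mono) auto
  then have "((1 - \<epsilon>) * c) / ((1 + \<epsilon>) * d) \<le> a / b"
    using e q(2) s(2) by (intro cross) (auto simp: mult_ac)
  then have "(1 - \<epsilon>) / (1 + \<epsilon>) * s\<^sup>2 \<le> q\<^sup>2"
    unfolding q s by simp
  then have "sqrt ((1 - \<epsilon>) / (1 + \<epsilon>) * s\<^sup>2) \<le> sqrt (q\<^sup>2)" by (rule real_sqrt_le_mono)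
  then show "sqrt ((1 - \<epsilon>) / (1 + \<epsilon>)) * \<bar>s\<bar> \<le> \<bar>q\<bar>"
    unfolding real_sqrt_mult real_sqrt_abs .
  have "((1 - \<epsilon>) * a) * d \<le> c * ((1 + \<epsilon>) * b)"
    using ac bd e q s assms by (intro mult_mono) auto
  then have "a / b \<le> ((1 + \<epsilon>) * c) / ((1 - \<epsilon>) * d)"
    using e q(2) s(2) by (intro cross) (auto simp: mult_ac)
  then have "q\<^sup>2 \<le> (1 + \<epsilon>) / (1 - \<epsilon>) * s\<^sup>2"
    unfolding q s by simp
  then have "sqrt (q\<^sup>2) \<le> sqrt ((1 + \<epsilon>) / (1 - \<epsilon>) * s\<^sup>2)" by (rule real_sqrt_le_mono)
  then show "\<bar>q\<bar> \<le> sqrt ((1 + \<epsilon>) / (1 - \<epsilon>)) * \<bar>s\<bar>"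
    unfolding real_sqrt_mult real_sqrt_abs .
qed

theorem lemma3p4:
  fixes m n d k :: nat and \<epsilon> :: real
    and M \<Omega> P Qsk Rsk Q R :: "real mat"
  assumes "M \<in> carrier_mat m n"
    and "0 \<le> \<epsilon>" and "\<epsilon> < 1"
    and "\<Omega> \<in> carrier_mat d m"
    and "eps_embedding \<epsilon> \<Omega> (mat_range M)"
    and "is_perm_mat n P"
    and "1 \<le> k" and "k \<le> n"
    and "partial_qr k ((\<Omega> * M) * P) Qsk Rsk"
    and "partial_qr k (M * P) Q R"
    and "det (leading_block k R) \<noteq> 0"
    and "det (leading_block k Rsk) \<noteq> 0"
  shows "\<forall>i<k. \<forall>j<n - k. \<forall>Qbsk Rbsk Qb Rb.
     partial_qr k (Rsk * col_swap_mat n i (k + j)) Qbsk Rbsk \<longrightarrow>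
     partial_qr k (R * col_swap_mat n i (k + j)) Qb Rb \<longrightarrow>
       sqrt ((1 - \<epsilon>) / (1 + \<epsilon>)) * \<bar>det (leading_block k Rbsk) / det (leading_block k Rsk)\<bar>
         \<le> \<bar>det (leading_block k Rb) / det (leading_block k R)\<bar> \<and>
       \<bar>det (leading_block k Rb) / det (leading_block k R)\<bar>
         \<le> sqrt ((1 + \<epsilon>) / (1 - \<epsilon>)) * \<bar>det (leading_block k Rbsk) / det (leading_block k Rsk)\<bar>"
proof (intro allI impI)
  fix i j Qbsk Rbsk Qb Rb
  assume i: "i < k" and j: "j < n - k"
    and qrbsk: "partial_qr k (Rsk * col_swap_mat n i (k + j)) Qbsk Rbsk"
    and qrb: "partial_qr k (R * col_swap_mat n i (k + j)) Qb Rb"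
  note M = assms(1) and W = assms(4)
  define A where "A = M * P"
  define C where "C = first_cols k A"
  have P: "P \<in> carrier_mat n n"
    using assms(6) by (auto simp: is_perm_mat_def perm_mat_def)
  have A: "A \<in> carrier_mat m n" using M P by (simp add: A_def)
  have WA: "\<Omega> * A \<in> carrier_mat d n" using W A by simp
  have C: "C \<in> carrier_mat m k" unfolding C_def using A by (rule first_cols_carrier)
  have Csk: "first_cols k (\<Omega> * A) = \<Omega> * C"
    unfolding C_def by (rule first_cols_mult[OF W A assms(8)])
  have qr: "partial_qr k A Q R" using assms(10) by (simp add: A_def)
  have qrsk: "partial_qr k (\<Omega> * A) Qsk Rsk"
    using assms(9) assoc_mult_mat[OF W M P] by (simp add: A_def)
  have l: "k \<le> k + j" "k + j < n" using j by auto
  have bounds: "(1 - \<epsilon>) * col_dist2 C i (col A c) \<le> col_dist2 (\<Omega> * C) i (col (\<Omega> * A) c)"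
      "col_dist2 (\<Omega> * C) i (col (\<Omega> * A) c) \<le> (1 + \<epsilon>) * col_dist2 C i (col A c)"
    if c: "c < n" for c
  proof -
    have x: "col A c \<in> carrier_vec m" using A by auto
    have wx: "col (\<Omega> * A) c = \<Omega> *\<^sub>v col A c" using W A c by (intro eq_vecI) auto
    have dist: "\<bar>(\<Omega> *\<^sub>v r) \<bullet> (\<Omega> *\<^sub>v r) - r \<bullet> r\<bar> \<le> \<epsilon> * (r \<bullet> r)"
      if "r \<in> col_residuals C i (col A c)" for r
    proof (rule eps_embedding_norm[OF assms(5)])
      show "r \<in> mat_range M"
        using first_cols_residual_in_range[OF A assms(8) c] that mat_range_mult_subset[OF M P]
        by (auto simp: C_def A_def)
    qed
    show "(1 - \<epsilon>) * col_dist2 C i (col A c) \<le> col_dist2 (\<Omega> * C) i (col (\<Omega> * A) c)"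
      "col_dist2 (\<Omega> * C) i (col (\<Omega> * A) c) \<le> (1 + \<epsilon>) * col_dist2 C i (col A c)"
      unfolding wx using col_dist2_sketch_bounds[OF C W x i assms(2,3) dist] by blast+
  qed
  have "i < n" using i assms(8) by simp
  note ratio = partial_qr_swap_det_ratio[OF qr A i l qrb assms(11), folded C_def]
  note ratio_sk = partial_qr_swap_det_ratio[OF qrsk WA i l qrbsk assms(12), unfolded Csk]
  have nonneg: "0 \<le> col_dist2 C i (col A (k + j))"
      "0 \<le> col_dist2 (\<Omega> * C) i (col (\<Omega> * A) (k + j))"
    using C i by (auto intro!: col_dist2_nonneg)
  show "sqrt ((1 - \<epsilon>) / (1 + \<epsilon>)) * \<bar>det (leading_block k Rbsk) / det (leading_block k Rsk)\<bar>
         \<le> \<bar>det (leading_block k Rb) / det (leading_block k R)\<bar> \<and>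
       \<bar>det (leading_block k Rb) / det (leading_block k R)\<bar>
         \<le> sqrt ((1 + \<epsilon>) / (1 - \<epsilon>)) * \<bar>det (leading_block k Rbsk) / det (leading_block k Rsk)\<bar>"
    using sqrt_quotient_bounds[OF assms(2,3) ratio ratio_sk nonneg
        bounds[OF l(2)] bounds[OF \<open>i < n\<close>]] by blast
qed

end
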